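(* Let $t,u$ be terms, $k\in\mathbb{N}$, and $\vec{x}=(x_1,\dots,x_k)$ a list of pairwise distinct variables with $\mathrm{Fv}(t)\cup\mathrm{Fv}(u)\subseteq\{x_1,\dots,x_k\}$. If $t\simeq_{\mathsf{shuf}}u$ then $[\![t]\!]_{\vec{x}}=[\![u]\!]_{\vec{x}}$.
   Context: Terms: $t ::= x \mid \lambda x.t \mid tu$ (up to $\alpha$); values $v ::= x \mid \lambda x.t$; $\mathrm{Fv}(t)$ free variables; $t\{v/x\}$ substitution. Root steps: ($\beta_v$) $(\lambda x.t)v \mapsto t\{v/x\}$, $v$ a value; ($\sigma_1$) $(\lambda x.t)us \mapsto (\lambda x.ts)u$ if $x\notin\mathrm{Fv}(s)$; ($\sigma_3$) $v((\lambda x.s)u)\mapsto(\lambda x.vs)u$ if $v$ a value, $x\notin\mathrm{Fv}(v)$. $\mathsf{shuf}$-reduction is the closure of the union of these root steps under arbitrary term contexts (including under $\lambda$), and $\simeq_{\mathsf{shuf}}$ its reflexive-symmetric-transitive closure. Types: positive types are finite multisets $[(P_1,Q_1),\dots,(P_n,Q_n)]$ of pairs of positive types ($\mathbf{0}$ empty, $\uplus$ union). Environments map variables to positive types (finitely many non-$\mathbf{0}$), combined pointwise by $\uplus$. Rules: (ax) $x\colon P\vdash x\colon P$; ($\lambda$) from $\Gamma_i,x\colon P_i\vdash t\colon Q_i$ ($1\le i\le n$, $n\ge0$) infer $\biguplus_i\Gamma_i\vdash\lambda x.t\colon[(P_1,Q_1),\dots,(P_n,Q_n)]$; ($@$) from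 $\Gamma\vdash t\colon[(P,Q)]$ and $\Delta\vdash u\colon P$ infer $\Gamma\uplus\Delta\vdash tu\colon Q$. Relational semantics: $[\![t]\!]_{\vec{x}}=\{((P_1,\dots,P_k),Q)\mid x_1\colon P_1,\dots,x_k\colon P_k\vdash t\colon Q\text{ derivable}\}$. *)

theory Defs
  imports "HOL-Library.Multiset"
begin

section \<open>Terms\<close>

text \<open>
  Terms up to alpha-equivalence are represented by de Bruijn terms. The variables are the
  natural numbers: under \<open>d\<close> binders, the index \<open>d + i\<close> is an occurrence of the free
  variable \<open>i\<close>, and the indices below \<open>d\<close> are bound.
\<close>

datatype trm = Var nat | Lam trm | App trm trm

fun is_value :: "trm \<Rightarrow> bool" where
  "is_value (Var x) = True"
| "is_value (Lam t) = True"
| "is_value (App t u) = False"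

fun Fv :: "trm \<Rightarrow> nat set" where
  "Fv (Var x) = {x}"
| "Fv (Lam t) = {x. Suc x \<in> Fv t}"
| "Fv (App t u) = Fv t \<union> Fv u"

text \<open>\<open>lift d t\<close> is \<open>t\<close> seen in the scope of one more binder, inserted at level \<open>d\<close>.\<close>

fun lift :: "nat \<Rightarrow> trm \<Rightarrow> trm" where
  "lift d (Var x) = (if x < d then Var x else Var (Suc x))"
| "lift d (Lam t) = Lam (lift (Suc d) t)"
| "lift d (App t u) = App (lift d t) (lift d u)"

text \<open>
  \<open>subst d v t\<close> substitutes \<open>v\<close> for the index \<open>d\<close> in \<open>t\<close> and removes the binder at that
  level, so that \<open>subst 0 v t\<close> is \<open>t{v/x}\<close> when \<open>t\<close> is the body of \<open>\<lambda>x.t\<close>.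
\<close>

fun subst :: "nat \<Rightarrow> trm \<Rightarrow> trm \<Rightarrow> trm" where
  "subst d v (Var x) = (if x < d then Var x else if x = d then v else Var (x - 1))"
| "subst d v (Lam t) = Lam (subst (Suc d) (lift 0 v) t)"
| "subst d v (App t u) = App (subst d v t) (subst d v u)"

section \<open>Shuffling reduction\<close>

text \<open>
  The side conditions \<open>x \<notin> Fv(s)\<close> of \<open>\<sigma>\<^sub>1\<close> and \<open>x \<notin> Fv(v)\<close> of \<open>\<sigma>\<^sub>3\<close> are rendered by
  lifting the term that enters the scope of the binder.
\<close>

inductive shuf_root :: "trm \<Rightarrow> trm \<Rightarrow> bool" where
  beta_v: "is_value v \<Longrightarrow> shuf_root (App (Lam t) v) (subst 0 v t)"
| sigma1: "shuf_root (App (App (Lam t) u) s) (App (Lam (App t (lift 0 s))) u)"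
| sigma3: "is_value v \<Longrightarrow> shuf_root (App v (App (Lam s) u)) (App (Lam (App (lift 0 v) s)) u)"

inductive shuf :: "trm \<Rightarrow> trm \<Rightarrow> bool" where
  root: "shuf_root t t' \<Longrightarrow> shuf t t'"
| lam: "shuf t t' \<Longrightarrow> shuf (Lam t) (Lam t')"
| appL: "shuf t t' \<Longrightarrow> shuf (App t u) (App t' u)"
| appR: "shuf u u' \<Longrightarrow> shuf (App t u) (App t u')"

abbreviation shuf_equiv :: "trm \<Rightarrow> trm \<Rightarrow> bool"  (infix "\<simeq>\<^sub>s\<^sub>h\<^sub>u\<^sub>f" 50) where
  "t \<simeq>\<^sub>s\<^sub>h\<^sub>u\<^sub>f u \<equiv> equivclp shuf t u"

section \<open>Positive types and typing\<close>

datatype ptype = Pos (pairs: "(ptype \<times> ptype) multiset")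

text \<open>\<open>0\<close> is the empty multiset and \<open>+\<close> is multiset union.\<close>

instantiation ptype :: comm_monoid_add
begin

definition zero_ptype :: ptype where "0 = Pos {#}"

definition plus_ptype :: "ptype \<Rightarrow> ptype \<Rightarrow> ptype" where "P + Q = Pos (pairs P + pairs Q)"

instance
  by standard (simp_all add: zero_ptype_def plus_ptype_def ac_simps)

end

type_synonym env = "nat \<Rightarrow> ptype"

text \<open>
  In the rule \<open>lam\<close>, \<open>case_nat (P i) (\<Gamma> i)\<close> is the environment \<open>\<Gamma>\<^sub>i, x: P\<^sub>i\<close> for the body of the
  abstraction: the bound variable has index 0 there and the free variables are shifted by one.
  Environments are not restricted to finite support in the type; lemma
  \<open>typing_finite_support\<close> shows that derivable judgements only have such environments.
\<close>

inductive typing :: "env \<Rightarrow> trm \<Rightarrow> ptype \<Rightarrow> bool"  ("_ \<turnstile> _ : _" [51, 51, 51] 50) where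
  ax: "(\<lambda>y. 0)(x := P) \<turnstile> Var x : P"
| lam: "(\<And>i. i < n \<Longrightarrow> case_nat (P i) (\<Gamma> i) \<turnstile> t : Q i) \<Longrightarrow>
    (\<lambda>y. \<Sum>i<n. \<Gamma> i y) \<turnstile> Lam t : Pos (mset (map (\<lambda>i. (P i, Q i)) [0..<n]))"
| app: "\<Gamma> \<turnstile> t : Pos {#(P, Q)#} \<Longrightarrow> \<Delta> \<turnstile> u : P \<Longrightarrow> (\<lambda>y. \<Gamma> y + \<Delta> y) \<turnstile> App t u : Q"

lemma typing_finite_support: "\<Gamma> \<turnstile> t : Q \<Longrightarrow> finite {y. \<Gamma> y \<noteq> 0}"
proof (induction rule: typing.induct)
  case (ax x P)
  have "{y. ((\<lambda>y. 0)(x := P)) y \<noteq> 0} \<subseteq> {x}" by auto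
  then show ?case using finite_subset by blast
next
  case (lam n P \<Gamma> t Q)
  have fin: "finite {y. \<Gamma> i y \<noteq> 0}" if "i < n" for i
  proof -
    have "{y. \<Gamma> i y \<noteq> 0} = Suc -` {y. case_nat (P i) (\<Gamma> i) y \<noteq> 0}" by auto
    then show ?thesis using finite_vimageI[OF lam.IH[OF that], of Suc] by simp
  qed
  have "{y. (\<Sum>i<n. \<Gamma> i y) \<noteq> 0} \<subseteq> (\<Union>i<n. {y. \<Gamma> i y \<noteq> 0})"
    by (auto intro: ccontr dest: sum.not_neutral_contains_not_neutral)
  then show ?case using fin by (meson finite_UN_I finite_lessThan finite_subset lessThan_iff)
next
  case (app \<Gamma> t P Q \<Delta> u)
  have "{y. \<Gamma> y + \<Delta> y \<noteq> 0} \<subseteq> {y. \<Gamma> y \<noteq> 0} \<union> {y. \<Delta> y \<noteq> 0}" by auto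
  then show ?case using app.IH by (meson finite_UnI finite_subset)
qed

section \<open>Relational semantics\<close>

text \<open>\<open>env_of [x\<^sub>1, \<dots>, x\<^sub>k] [P\<^sub>1, \<dots>, P\<^sub>k]\<close> is the environment \<open>x\<^sub>1: P\<^sub>1, \<dots>, x\<^sub>k: P\<^sub>k\<close>.\<close>

definition env_of :: "nat list \<Rightarrow> ptype list \<Rightarrow> env" where
  "env_of xs Ps = (\<lambda>y. case map_of (zip xs Ps) y of None \<Rightarrow> 0 | Some P \<Rightarrow> P)"

definition sem :: "nat list \<Rightarrow> trm \<Rightarrow> (ptype list \<times> ptype) set" where
  "sem xs t = {(Ps, Q). length Ps = length xs \<and> env_of xs Ps \<turnstile> t : Q}"

end

theory Submission imports Defs "HOL-Library.Function_Algebras" begin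

text \<open>
  Typability is invariant under a single root step, in both directions. For \<open>\<beta>\<^sub>v\<close> this is a
  substitution lemma that is an equivalence: a typing of \<open>t{v/x}\<close> is the same as a typing of
  \<open>t\<close> giving \<open>x\<close> some type \<open>P\<close>, together with a typing of \<open>v\<close> with \<open>P\<close>. It holds because typings
  of values can be split and merged along sums of types: the occurrences of \<open>x\<close> partition \<open>P\<close>.
  The \<open>\<sigma>\<close>-rules only rearrange the premises of a derivation. Environments assign types
  to all variables, so the free variables of the intermediate terms of a conversion do not matter.
\<close>

section \<open>Inversion of typing\<close>

text \<open>\<open>case_nat\<close> generalised to an arbitrary level: the environment of a term in
  the scope of one more binder at index \<open>d\<close>. Arbitrary levels are needed because
  \<open>lift\<close> and \<open>subst\<close> descend under binders.\<close>

definition ins :: "nat \<Rightarrow> ptype \<Rightarrow> env \<Rightarrow> env" where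
  "ins d P \<Gamma> = (\<lambda>y. if y < d then \<Gamma> y else if y = d then P else \<Gamma> (y - 1))"

lemma case_nat_eq_ins: "case_nat P \<Gamma> = ins 0 P \<Gamma>"
  by (auto simp: ins_def fun_eq_iff split: nat.split)

lemma ins_cases: obtains P \<Delta> where "\<Gamma> = ins d P \<Delta>"
proof
  show "\<Gamma> = ins d (\<Gamma> d) (\<lambda>y. if y < d then \<Gamma> y else \<Gamma> (Suc y))"
    by (auto simp: ins_def fun_eq_iff)
qed

lemma ins_eq_iff [simp]: "ins d P \<Gamma> = ins d Q \<Delta> \<longleftrightarrow> P = Q \<and> \<Gamma> = \<Delta>"
proof
  assume eq: "ins d P \<Gamma> = ins d Q \<Delta>"
  have "\<Gamma> y = \<Delta> y" for y
    using fun_cong[OF eq, of y] fun_cong[OF eq, of "Suc y"] by (auto simp: ins_def split: if_splits)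
  moreover have "P = Q" using fun_cong[OF eq, of d] by (simp add: ins_def)
  ultimately show "P = Q \<and> \<Gamma> = \<Delta>" by auto
qed auto

lemma ins_plus: "ins d P \<Gamma> + ins d Q \<Delta> = ins d (P + Q) (\<Gamma> + \<Delta>)"
  by (auto simp: ins_def fun_eq_iff)

lemma ins_zero: "ins d 0 0 = 0"
  by (auto simp: ins_def fun_eq_iff)

lemma ins_eq_zero_iff [simp]: "ins d P \<Gamma> = 0 \<longleftrightarrow> P = 0 \<and> \<Gamma> = 0"
  by (metis ins_eq_iff ins_zero)

lemma ins_eq_plus_iff:
  "ins d P \<Gamma> = \<Delta>1 + \<Delta>2 \<longleftrightarrow>
    (\<exists>P1 P2 \<Gamma>1 \<Gamma>2. \<Delta>1 = ins d P1 \<Gamma>1 \<and> \<Delta>2 = ins d P2 \<Gamma>2 \<and> P = P1 + P2 \<and> \<Gamma> = \<Gamma>1 + \<Gamma>2)"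
proof -
  obtain P1 \<Gamma>1 where 1: "\<Delta>1 = ins d P1 \<Gamma>1" by (rule ins_cases)
  obtain P2 \<Gamma>2 where 2: "\<Delta>2 = ins d P2 \<Gamma>2" by (rule ins_cases)
  show ?thesis unfolding 1 2 ins_plus by auto
qed

text \<open>Stated with predicates \<open>A\<close> and \<open>B\<close> so that unfolding it pushes
  an inserted index through the environment splittings in the inversion rules.\<close>

lemma ex_ins_eq_plus_iff:
  "(\<exists>\<Delta>1 \<Delta>2. ins d P \<Gamma> = \<Delta>1 + \<Delta>2 \<and> A \<Delta>1 \<and> B \<Delta>2) \<longleftrightarrow>
    (\<exists>P1 P2 \<Gamma>1 \<Gamma>2. P = P1 + P2 \<and> \<Gamma> = \<Gamma>1 + \<Gamma>2 \<and> A (ins d P1 \<Gamma>1) \<and> B (ins d P2 \<Gamma>2))"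
  unfolding ins_eq_plus_iff by blast

text \<open>Going under a binder moves level \<open>d\<close> to \<open>Suc d\<close>, as in the
  \<open>Lam\<close> equations of \<open>lift\<close> and \<open>subst\<close>.\<close>

lemma ins_0_ins: "ins 0 P (ins d Q \<Gamma>) = ins (Suc d) Q (ins 0 P \<Gamma>)"
  by (auto simp: ins_def fun_eq_iff)

lemma ins_eq_single_less:
  assumes "x < d"
  shows "ins d P \<Gamma> = (\<lambda>y. 0)(x := Q) \<longleftrightarrow> P = 0 \<and> \<Gamma> = (\<lambda>y. 0)(x := Q)"
proof -
  have "(\<lambda>y. 0)(x := Q) = ins d 0 ((\<lambda>y. 0)(x := Q))"
    using assms by (auto simp: ins_def fun_eq_iff)
  then show ?thesis by (metis ins_eq_iff)
qed

lemma ins_eq_single_same: "ins d P \<Gamma> = (\<lambda>y. 0)(d := Q) \<longleftrightarrow> P = Q \<and> \<Gamma> = 0"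
proof -
  have "(\<lambda>y. 0)(d := Q) = ins d Q 0" by (auto simp: ins_def fun_eq_iff)
  then show ?thesis by simp
qed

lemma ins_eq_single_Suc:
  assumes "d \<le> x"
  shows "ins d P \<Gamma> = (\<lambda>y. 0)(Suc x := Q) \<longleftrightarrow> P = 0 \<and> \<Gamma> = (\<lambda>y. 0)(x := Q)"
proof -
  have "(\<lambda>y. 0)(Suc x := Q) = ins d 0 ((\<lambda>y. 0)(x := Q))"
    using assms by (auto simp: ins_def fun_eq_iff)
  then show ?thesis by simp
qed

section \<open>Inversion for variables, applications and abstractions\<close>

lemma typing_Var_iff: "\<Gamma> \<turnstile> Var x : P \<longleftrightarrow> \<Gamma> = (\<lambda>y. 0)(x := P)"
  by (auto intro: typing.ax elim: typing.cases)

lemma typing_App_iff: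
  "\<Gamma> \<turnstile> App t u : Q \<longleftrightarrow>
    (\<exists>P \<Gamma>1 \<Gamma>2. \<Gamma> = \<Gamma>1 + \<Gamma>2 \<and> \<Gamma>1 \<turnstile> t : Pos {#(P, Q)#} \<and> \<Gamma>2 \<turnstile> u : P)"
  (is "_ \<longleftrightarrow> ?R")
proof
  show "\<Gamma> \<turnstile> App t u : Q \<Longrightarrow> ?R"
    by (erule typing.cases) (auto simp: plus_fun_def)
qed (auto simp: plus_fun_def intro: typing.app)

text \<open>The rule \<open>lam\<close> with its premises added one at a time.\<close>

inductive lam_typing :: "trm \<Rightarrow> env \<Rightarrow> (ptype \<times> ptype) multiset \<Rightarrow> bool" for t where
  empty: "lam_typing t 0 {#}"
| add: "ins 0 P \<Gamma> \<turnstile> t : Q \<Longrightarrow> lam_typing t \<Delta> M \<Longrightarrow> lam_typing t (\<Gamma> + \<Delta>) (add_mset (P, Q) M)"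

lemma lam_typing_sum:
  assumes "\<And>i. i < n \<Longrightarrow> case_nat (P i) (\<Gamma> i) \<turnstile> t : Q i"
  shows "lam_typing t (\<lambda>y. \<Sum>i<n. \<Gamma> i y) (mset (map (\<lambda>i. (P i, Q i)) [0..<n]))"
  using assms
proof (induction n)
  case 0
  then show ?case using lam_typing.empty by (simp add: zero_fun_def)
next
  case (Suc n)
  have "lam_typing t (\<Gamma> n + (\<lambda>y. \<Sum>i<n. \<Gamma> i y))
      (add_mset (P n, Q n) (mset (map (\<lambda>i. (P i, Q i)) [0..<n])))"
    using Suc by (intro lam_typing.add) (auto simp: case_nat_eq_ins[symmetric])
  then show ?case by (simp add: plus_fun_def add.commute)
qed

lemma lam_typing_imp_typing: "lam_typing t \<Gamma> M \<Longrightarrow> \<Gamma> \<turnstile> Lam t : Pos M"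
proof (induction rule: lam_typing.induct)
  case empty
  show ?case using typing.lam[of 0] by (simp add: zero_fun_def)
next
  case (add P \<Gamma> Q \<Delta> M)
  from add.IH obtain n P' \<Gamma>' Q' where
    \<Delta>: "\<Delta> = (\<lambda>y. \<Sum>i<n. \<Gamma>' i y)" and M: "M = mset (map (\<lambda>i. (P' i, Q' i)) [0..<n])"
    and prem: "\<And>i. i < n \<Longrightarrow> case_nat (P' i) (\<Gamma>' i) \<turnstile> t : Q' i"
    by (auto elim: typing.cases)
  \<comment> \<open>The new premise takes the fresh index \<open>n\<close>; the order of the
    premises is immaterial, since only their sum and their multiset enter the conclusion.\<close>
  have "(\<lambda>y. \<Sum>i<Suc n. (\<Gamma>'(n := \<Gamma>)) i y) \<turnstile> Lam t :
      Pos (mset (map (\<lambda>i. ((P'(n := P)) i, (Q'(n := Q)) i)) [0..<Suc n]))"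
    by (rule typing.lam) (use prem add.hyps in \<open>auto simp: case_nat_eq_ins less_Suc_eq\<close>)
  moreover have "(\<lambda>y. \<Sum>i<Suc n. (\<Gamma>'(n := \<Gamma>)) i y) = \<Gamma> + \<Delta>"
    by (auto simp: \<Delta> fun_eq_iff add.commute)
  moreover have "map (\<lambda>i. ((P'(n := P)) i, (Q'(n := Q)) i)) [0..<Suc n] =
      map (\<lambda>i. (P' i, Q' i)) [0..<n] @ [(P, Q)]" by auto
  ultimately show ?case unfolding M by (metis add_mset_add_single mset_append mset_single_iff)
qed

lemma typing_Lam_iff_lam_typing: "\<Gamma> \<turnstile> Lam t : Pos M \<longleftrightarrow> lam_typing t \<Gamma> M"
proof
  show "\<Gamma> \<turnstile> Lam t : Pos M \<Longrightarrow> lam_typing t \<Gamma> M"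
    by (erule typing.cases) (auto intro: lam_typing_sum simp del: mset_map)
qed (rule lam_typing_imp_typing)

text \<open>Exchange argument: any chosen pair, not just the last one added, can be treated as the
  last.\<close>

lemma lam_typing_add_msetD:
  "lam_typing t \<Gamma> (add_mset (P, Q) M) \<Longrightarrow>
    \<exists>\<Gamma>1 \<Gamma>2. \<Gamma> = \<Gamma>1 + \<Gamma>2 \<and> ins 0 P \<Gamma>1 \<turnstile> t : Q \<and> lam_typing t \<Gamma>2 M"
proof (induction \<Gamma> "add_mset (P, Q) M" arbitrary: M rule: lam_typing.induct)
  case (add P' \<Gamma> Q' \<Delta> N)
  show ?case
  proof (cases "(P', Q') = (P, Q)")
    case True
    then show ?thesis using add by auto
  next
    case False
    \<comment> \<open>The last pair added is a different one, so the chosen pair already occurs in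
      \<open>N\<close>; it is extracted there and the last premise is added back to the
      rest.\<close>
    with add.hyps(4) obtain K where K: "N = add_mset (P, Q) K" "M = add_mset (P', Q') K"
      by (auto simp: add_eq_conv_ex)
    from add.hyps(3)[OF K(1)] obtain \<Gamma>1 \<Gamma>2 where
      "\<Delta> = \<Gamma>1 + \<Gamma>2" "ins 0 P \<Gamma>1 \<turnstile> t : Q" "lam_typing t \<Gamma>2 K" by blast
    moreover from this have "lam_typing t (\<Gamma> + \<Gamma>2) M"
      using lam_typing.add add.hyps(1) K(2) by blast
    ultimately show ?thesis by (metis add.left_commute)
  qed
qed simp

lemma typing_Lam_empty_iff [simp]: "\<Gamma> \<turnstile> Lam t : Pos {#} \<longleftrightarrow> \<Gamma> = 0"
  unfolding typing_Lam_iff_lam_typing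
  by (auto intro: lam_typing.empty elim: lam_typing.cases)

lemma typing_Lam_add_mset_iff:
  "\<Gamma> \<turnstile> Lam t : Pos (add_mset (P, Q) M) \<longleftrightarrow>
    (\<exists>\<Gamma>1 \<Gamma>2. \<Gamma> = \<Gamma>1 + \<Gamma>2 \<and> ins 0 P \<Gamma>1 \<turnstile> t : Q \<and> \<Gamma>2 \<turnstile> Lam t : Pos M)"
  unfolding typing_Lam_iff_lam_typing by (auto intro: lam_typing.add dest: lam_typing_add_msetD)

lemma typing_Lam_single_iff: "\<Gamma> \<turnstile> Lam t : Pos {#(P, Q)#} \<longleftrightarrow> ins 0 P \<Gamma> \<turnstile> t : Q"
  by (simp add: typing_Lam_add_mset_iff)

lemma typing_Lam_cong:
  assumes "\<And>\<Gamma> Q. \<Gamma> \<turnstile> t : Q \<longleftrightarrow> \<Gamma> \<turnstile> t' : Q"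
  shows "\<Gamma> \<turnstile> Lam t : Pos M \<longleftrightarrow> \<Gamma> \<turnstile> Lam t' : Pos M"
proof (induction M arbitrary: \<Gamma>)
  case (add x M)
  then show ?case using assms by (cases x) (simp add: typing_Lam_add_mset_iff)
qed simp

section \<open>Values\<close>

text \<open>A value used zero times consumes no resources: an axiom at type \<open>0\<close> has the
  zero environment, and an abstraction of type \<open>0\<close> has no premises.\<close>

lemma typing_value_zero_iff: "is_value v \<Longrightarrow> \<Gamma> \<turnstile> v : 0 \<longleftrightarrow> \<Gamma> = 0"
  by (cases v) (auto simp: typing_Var_iff zero_ptype_def fun_eq_iff)

text \<open>The premises for the pairs in \<open>M + N\<close> are divided into those for
  \<open>M\<close> and those for \<open>N\<close>.\<close>

lemma typing_Lam_union_iff: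
  "\<Gamma> \<turnstile> Lam t : Pos (M + N) \<longleftrightarrow>
    (\<exists>\<Gamma>1 \<Gamma>2. \<Gamma> = \<Gamma>1 + \<Gamma>2 \<and> \<Gamma>1 \<turnstile> Lam t : Pos M \<and> \<Gamma>2 \<turnstile> Lam t : Pos N)"
proof (induction M arbitrary: \<Gamma>)
  case (add x M)
  obtain P Q where x: "x = (P, Q)" by force
  have "\<Gamma> \<turnstile> Lam t : Pos (add_mset x M + N) \<longleftrightarrow> (\<exists>\<Gamma>1 \<Gamma>2 \<Gamma>3. \<Gamma> = \<Gamma>1 + (\<Gamma>2 + \<Gamma>3) \<and>
      ins 0 P \<Gamma>1 \<turnstile> t : Q \<and> \<Gamma>2 \<turnstile> Lam t : Pos M \<and> \<Gamma>3 \<turnstile> Lam t : Pos N)"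
    unfolding x union_mset_add_mset_left typing_Lam_add_mset_iff add by blast
  then show ?case
    unfolding x typing_Lam_add_mset_iff add.assoc[symmetric] by blast
qed simp

lemma typing_value_plus_iff:
  assumes "is_value v"
  shows "\<Gamma> \<turnstile> v : P + Q \<longleftrightarrow> (\<exists>\<Gamma>1 \<Gamma>2. \<Gamma> = \<Gamma>1 + \<Gamma>2 \<and> \<Gamma>1 \<turnstile> v : P \<and> \<Gamma>2 \<turnstile> v : Q)"
proof (cases v)
  case (Var x)
  have "(\<lambda>y. 0)(x := P + Q) = (\<lambda>y. 0)(x := P) + (\<lambda>y. 0)(x := Q)"
    by (auto simp: fun_eq_iff)
  then show ?thesis by (simp add: Var typing_Var_iff)
next
  case (Lam t)
  then show ?thesis using typing_Lam_union_iff[of \<Gamma> t "pairs P" "pairs Q"]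
    by (simp add: plus_ptype_def)
qed (use assms in simp)

section \<open>Lifting and substitution\<close>

text \<open>Typing has no weakening: a lifted term does not mention index \<open>d\<close>, so the
  type there is forced to be \<open>0\<close>. This is how the side conditions of the \<sigma>-rules
  enter.\<close>

lemma typing_lift_iff: "ins d P \<Gamma> \<turnstile> lift d t : Q \<longleftrightarrow> P = 0 \<and> \<Gamma> \<turnstile> t : Q"
proof (induction t arbitrary: d P \<Gamma> Q)
  case (Var x)
  show ?case by (simp add: typing_Var_iff ins_eq_single_less ins_eq_single_Suc)
next
  case (Lam t)
  have "ins d P \<Gamma> \<turnstile> Lam (lift (Suc d) t) : Pos M \<longleftrightarrow> P = 0 \<and> \<Gamma> \<turnstile> Lam t : Pos M" for M
  \<comment> \<open>The body is typed once per element of \<open>M\<close>, so an inner induction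
    applies \<open>Lam.IH\<close> to one premise at a time.\<close>
  proof (induction M arbitrary: P \<Gamma>)
    case (add x M)
    obtain R S where x: "x = (R, S)" by force
    show ?case unfolding x typing_Lam_add_mset_iff ex_ins_eq_plus_iff ins_0_ins add Lam.IH
      by (metis add_0)
  qed simp
  then show ?case by (cases Q) simp
next
  case (App t u)
  show ?case unfolding lift.simps typing_App_iff ex_ins_eq_plus_iff App.IH
    by (metis add_0)
qed

lemma is_value_lift [simp]: "is_value (lift d v) = is_value v"
  by (cases v) auto

text \<open>\<open>P\<close> is the sum of the types at which the copies of \<open>v\<close>
  replacing index \<open>d\<close> are used. Subterms and premises each claim a share of
  \<open>P\<close>, and \<open>typing_value_plus_iff\<close> translates this into shares of the
  environment of \<open>v\<close>.\<close>

lemma typing_subst_iff: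
  assumes "is_value v"
  shows "\<Gamma> \<turnstile> subst d v t : Q \<longleftrightarrow>
    (\<exists>P \<Gamma>1 \<Gamma>2. \<Gamma> = \<Gamma>1 + \<Gamma>2 \<and> ins d P \<Gamma>1 \<turnstile> t : Q \<and> \<Gamma>2 \<turnstile> v : P)"
  using assms
proof (induction t arbitrary: d v \<Gamma> Q)
  case (Var x)
  \<comment> \<open>Away from \<open>d\<close> the type \<open>P\<close> must be \<open>0\<close>,
    so \<open>v\<close> contributes nothing; at \<open>d\<close> the whole environment goes to
    \<open>v\<close>. Writing \<open>x\<close> as \<open>Suc z\<close> exposes the decremented
    index.\<close>
  consider "x < d" | "x = d" | z where "x = Suc z" "d \<le> z"
    by (cases x) (auto, linarith)
  then show ?case
    using \<open>is_value v\<close> by cases (simp_all add: typing_Var_iff ins_eq_single_less ins_eq_single_same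
        ins_eq_single_Suc typing_value_zero_iff cong: conj_cong)
next
  case (Lam t)
  let ?s = "subst (Suc d) (lift 0 v) t"
  note v = \<open>is_value v\<close>
  have "\<Gamma> \<turnstile> Lam ?s : Pos M \<longleftrightarrow>
      (\<exists>P \<Gamma>1 \<Gamma>2. \<Gamma> = \<Gamma>1 + \<Gamma>2 \<and> ins d P \<Gamma>1 \<turnstile> Lam t : Pos M \<and> \<Gamma>2 \<turnstile> v : P)" for M
  proof (induction M arbitrary: \<Gamma>)
    case empty
    show ?case using v by (auto simp: typing_value_zero_iff)
  next
    case (add x M)
    obtain R S where x: "x = (R, S)" by force
    \<comment> \<open>The hypothesis for the body concerns \<open>lift 0 v\<close>, which takes type
      \<open>0\<close> at the bound variable; hence all of \<open>R\<close> stays with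
      \<open>t\<close>.\<close>
    have body: "ins 0 R \<Gamma> \<turnstile> ?s : S \<longleftrightarrow>
        (\<exists>P \<Gamma>1 \<Gamma>2. \<Gamma> = \<Gamma>1 + \<Gamma>2 \<and> ins 0 R (ins d P \<Gamma>1) \<turnstile> t : S \<and> \<Gamma>2 \<turnstile> v : P)" for \<Gamma>
    proof -
      have "ins 0 R \<Gamma> \<turnstile> ?s : S \<longleftrightarrow> (\<exists>P \<Delta>1 \<Delta>2. ins 0 R \<Gamma> = \<Delta>1 + \<Delta>2 \<and>
          ins (Suc d) P \<Delta>1 \<turnstile> t : S \<and> \<Delta>2 \<turnstile> lift 0 v : P)"
        by (rule Lam.IH) (simp add: v)
      also have "\<dots> \<longleftrightarrow>
          (\<exists>P \<Gamma>1 \<Gamma>2. \<Gamma> = \<Gamma>1 + \<Gamma>2 \<and> ins 0 R (ins d P \<Gamma>1) \<turnstile> t : S \<and> \<Gamma>2 \<turnstile> v : P)"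
        unfolding ex_ins_eq_plus_iff ins_0_ins typing_lift_iff by (metis add_0_right)
      finally show ?thesis .
    qed
    show ?case (is "?L \<longleftrightarrow> ?R")
    proof
      assume ?L
      then obtain \<Gamma>1 \<Gamma>2 P \<Delta>1 \<Delta>2 P' \<Delta>1' \<Delta>2' where
        "\<Gamma> = \<Gamma>1 + \<Gamma>2" "\<Gamma>1 = \<Delta>1 + \<Delta>2" "\<Gamma>2 = \<Delta>1' + \<Delta>2'"
        and t: "ins 0 R (ins d P \<Delta>1) \<turnstile> t : S" "ins d P' \<Delta>1' \<turnstile> Lam t : Pos M"
        and "\<Delta>2 \<turnstile> v : P" "\<Delta>2' \<turnstile> v : P'"
        unfolding x typing_Lam_add_mset_iff body add by blast
      \<comment> \<open>The shares of \<open>v\<close> for the new premise and for \<open>M\<close>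
        are merged into one typing at \<open>P + P'\<close>.\<close>
      then have "\<Gamma> = (\<Delta>1 + \<Delta>1') + (\<Delta>2 + \<Delta>2')" "\<Delta>2 + \<Delta>2' \<turnstile> v : P + P'"
        using v by (auto simp: typing_value_plus_iff ac_simps)
      moreover have "ins d (P + P') (\<Delta>1 + \<Delta>1') \<turnstile> Lam t : Pos (add_mset x M)"
        unfolding x typing_Lam_add_mset_iff using t ins_plus by metis
      ultimately show ?R by blast
    next
      assume ?R
      then obtain P P' \<Delta>1 \<Delta>1' \<Delta> where \<Gamma>: "\<Gamma> = (\<Delta>1 + \<Delta>1') + \<Delta>"
        and t: "ins 0 R (ins d P \<Delta>1) \<turnstile> t : S" "ins d P' \<Delta>1' \<turnstile> Lam t : Pos M"
        and "\<Delta> \<turnstile> v : P + P'"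
        unfolding x typing_Lam_add_mset_iff ex_ins_eq_plus_iff by blast
      \<comment> \<open>Conversely, the typing of \<open>v\<close> is cut along the shares claimed
        by the first premise and by the rest.\<close>
      then obtain \<Delta>2 \<Delta>2' where \<Delta>: "\<Delta> = \<Delta>2 + \<Delta>2'" and "\<Delta>2 \<turnstile> v : P" "\<Delta>2' \<turnstile> v : P'"
        using v by (auto simp: typing_value_plus_iff)
      moreover have "\<Gamma> = (\<Delta>1 + \<Delta>2) + (\<Delta>1' + \<Delta>2')" by (simp add: \<Gamma> \<Delta> ac_simps)
      ultimately show ?L
        unfolding x typing_Lam_add_mset_iff body add using t by blast
    qed
  qed
  then show ?case by (cases Q) (simp only: subst.simps)
next
  case (App t u)
  note v = \<open>is_value v\<close>
  show ?case (is "?L \<longleftrightarrow> ?R")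
  proof
    assume ?L
    then obtain R \<Gamma>1 \<Gamma>2 P \<Delta>1 \<Delta>2 P' \<Delta>1' \<Delta>2' where
      "\<Gamma> = \<Gamma>1 + \<Gamma>2" "\<Gamma>1 = \<Delta>1 + \<Delta>2" "\<Gamma>2 = \<Delta>1' + \<Delta>2'"
      and t: "ins d P \<Delta>1 \<turnstile> t : Pos {#(R, Q)#}" "ins d P' \<Delta>1' \<turnstile> u : R"
      and "\<Delta>2 \<turnstile> v : P" "\<Delta>2' \<turnstile> v : P'"
      unfolding subst.simps typing_App_iff App.IH[OF v] by blast
    then have "\<Gamma> = (\<Delta>1 + \<Delta>1') + (\<Delta>2 + \<Delta>2')" "\<Delta>2 + \<Delta>2' \<turnstile> v : P + P'"
      using v by (auto simp: typing_value_plus_iff ac_simps)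
    moreover have "ins d (P + P') (\<Delta>1 + \<Delta>1') \<turnstile> App t u : Q"
      unfolding typing_App_iff using t ins_plus by metis
    ultimately show ?R by blast
  next
    assume ?R
    then obtain R P P' \<Delta>1 \<Delta>1' \<Delta> where \<Gamma>: "\<Gamma> = (\<Delta>1 + \<Delta>1') + \<Delta>"
      and t: "ins d P \<Delta>1 \<turnstile> t : Pos {#(R, Q)#}" "ins d P' \<Delta>1' \<turnstile> u : R"
      and "\<Delta> \<turnstile> v : P + P'"
      unfolding typing_App_iff ex_ins_eq_plus_iff by blast
    then obtain \<Delta>2 \<Delta>2' where \<Delta>: "\<Delta> = \<Delta>2 + \<Delta>2'" and "\<Delta>2 \<turnstile> v : P" "\<Delta>2' \<turnstile> v : P'"
      using v by (auto simp: typing_value_plus_iff)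
    moreover have "\<Gamma> = (\<Delta>1 + \<Delta>2) + (\<Delta>1' + \<Delta>2')" by (simp add: \<Gamma> \<Delta> ac_simps)
    ultimately show ?L
      unfolding subst.simps typing_App_iff App.IH[OF v] using t by blast
  qed
qed

section \<open>Invariance under shuffling\<close>

lemma typing_App_Lam_iff:
  "\<Gamma> \<turnstile> App (Lam t) u : Q \<longleftrightarrow>
    (\<exists>P \<Gamma>1 \<Gamma>2. \<Gamma> = \<Gamma>1 + \<Gamma>2 \<and> ins 0 P \<Gamma>1 \<turnstile> t : Q \<and> \<Gamma>2 \<turnstile> u : P)"
  by (simp add: typing_App_iff typing_Lam_single_iff)

text \<open>The lifted argument has type \<open>0\<close> at the bound variable, so \<open>P\<close>
  goes entirely to \<open>t\<close>.\<close>

lemma typing_App_lift_right_iff: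
  "ins 0 P \<Gamma> \<turnstile> App t (lift 0 s) : Q \<longleftrightarrow>
    (\<exists>R \<Gamma>1 \<Gamma>2. \<Gamma> = \<Gamma>1 + \<Gamma>2 \<and> ins 0 P \<Gamma>1 \<turnstile> t : Pos {#(R, Q)#} \<and> \<Gamma>2 \<turnstile> s : R)"
  unfolding typing_App_iff ex_ins_eq_plus_iff typing_lift_iff by (metis add_0_right)

lemma typing_App_lift_left_iff:
  "ins 0 P \<Gamma> \<turnstile> App (lift 0 v) s : Q \<longleftrightarrow>
    (\<exists>R \<Gamma>1 \<Gamma>2. \<Gamma> = \<Gamma>1 + \<Gamma>2 \<and> \<Gamma>1 \<turnstile> v : Pos {#(R, Q)#} \<and> ins 0 P \<Gamma>2 \<turnstile> s : R)"
  unfolding typing_App_iff ex_ins_eq_plus_iff typing_lift_iff by (metis add_0)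

lemma shuf_root_typing_iff: "shuf_root t t' \<Longrightarrow> \<Gamma> \<turnstile> t : Q \<longleftrightarrow> \<Gamma> \<turnstile> t' : Q"
proof (induction rule: shuf_root.induct)
  case (beta_v v t)
  \<comment> \<open>The premises of the redex are exactly the decomposition in
    \<open>typing_subst_iff\<close> at \<open>d = 0\<close>.\<close>
  then show ?case unfolding typing_App_Lam_iff by (simp only: typing_subst_iff)
next
  case (sigma1 t u s)
  have comm: "(\<Gamma>1 + \<Gamma>2) + \<Gamma>3 = (\<Gamma>1 + \<Gamma>3) + \<Gamma>2" for \<Gamma>1 \<Gamma>2 \<Gamma>3 :: env
    unfolding add.assoc add.commute[of \<Gamma>2 \<Gamma>3] ..
  have "\<Gamma> \<turnstile> App (App (Lam t) u) s : Q \<longleftrightarrow> (\<exists>R P \<Gamma>1 \<Gamma>2 \<Gamma>3. \<Gamma> = (\<Gamma>1 + \<Gamma>2) + \<Gamma>3 \<and>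
      ins 0 P \<Gamma>1 \<turnstile> t : Pos {#(R, Q)#} \<and> \<Gamma>2 \<turnstile> u : P \<and> \<Gamma>3 \<turnstile> s : R)"
    unfolding typing_App_iff[of \<Gamma> "App (Lam t) u"] typing_App_Lam_iff by blast
  also have "\<dots> \<longleftrightarrow> (\<exists>R P \<Gamma>1 \<Gamma>2 \<Gamma>3. \<Gamma> = (\<Gamma>1 + \<Gamma>3) + \<Gamma>2 \<and>
      ins 0 P \<Gamma>1 \<turnstile> t : Pos {#(R, Q)#} \<and> \<Gamma>2 \<turnstile> u : P \<and> \<Gamma>3 \<turnstile> s : R)"
    \<comment> \<open>Only the environment equation changes under the quantifiers: the parts of
      \<open>u\<close> and \<open>s\<close> are swapped.\<close>
    by (intro ex_cong1 arg_cong2[where f = "(\<and>)"] arg_cong[where f = "(=) \<Gamma>"] comm refl)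
  also have "\<dots> \<longleftrightarrow> \<Gamma> \<turnstile> App (Lam (App t (lift 0 s))) u : Q"
    unfolding typing_App_Lam_iff typing_App_lift_right_iff by blast
  finally show ?case .
next
  case (sigma3 v s u)
  have "\<Gamma> \<turnstile> App v (App (Lam s) u) : Q \<longleftrightarrow> (\<exists>R P \<Gamma>1 \<Gamma>2 \<Gamma>3. \<Gamma> = \<Gamma>1 + (\<Gamma>2 + \<Gamma>3) \<and>
      \<Gamma>1 \<turnstile> v : Pos {#(R, Q)#} \<and> ins 0 P \<Gamma>2 \<turnstile> s : R \<and> \<Gamma>3 \<turnstile> u : P)"
    unfolding typing_App_iff[of \<Gamma> v] typing_App_Lam_iff by blast
  \<comment> \<open>The three premises keep their order, so reassociating the sum suffices.\<close>
  also have "\<dots> \<longleftrightarrow> \<Gamma> \<turnstile> App (Lam (App (lift 0 v) s)) u : Q"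
    unfolding typing_App_Lam_iff typing_App_lift_left_iff add.assoc[symmetric] by blast
  finally show ?case .
qed

lemma shuf_typing_iff: "shuf t t' \<Longrightarrow> \<Gamma> \<turnstile> t : Q \<longleftrightarrow> \<Gamma> \<turnstile> t' : Q"
proof (induction arbitrary: \<Gamma> Q rule: shuf.induct)
  case (root t t')
  then show ?case by (rule shuf_root_typing_iff)
next
  case (lam t t')
  \<comment> \<open>Writing \<open>Q\<close> as \<open>Pos (pairs Q)\<close> exposes the multiset
    required by \<open>typing_Lam_cong\<close>.\<close>
  then have "\<Gamma> \<turnstile> Lam t : Pos (pairs Q) \<longleftrightarrow> \<Gamma> \<turnstile> Lam t' : Pos (pairs Q)"
    by (intro typing_Lam_cong)
  then show ?case by simp
qed (simp_all only: typing_App_iff)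

lemma shuf_equiv_typing_iff: "t \<simeq>\<^sub>s\<^sub>h\<^sub>u\<^sub>f u \<Longrightarrow> \<Gamma> \<turnstile> t : Q \<longleftrightarrow> \<Gamma> \<turnstile> u : Q"
  by (induction rule: equivclp_induct) (auto simp: shuf_typing_iff)

theorem mainTheorem5:
  fixes t u :: trm and k :: nat and xs :: "nat list"
  assumes "length xs = k"
    and "distinct xs"
    and "Fv t \<union> Fv u \<subseteq> set xs"
    and "t \<simeq>\<^sub>s\<^sub>h\<^sub>u\<^sub>f u"
  shows "sem xs t = sem xs u"
  using shuf_equiv_typing_iff[OF assms(4)] by (simp add: sem_def)

end
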